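(* Let $G=(F,C,E)$ be a time-dependent graph with travel time functions $\tau_{ij}$, $(i,j)\in E$, let $\mathcal{T}=\{t_1,\dots,t_M\}$ be the set of time instants, and let $L_{ij}$, $v_{ij}$ be IGP parameters of $\tau_{ij}$ over $[0,T]$ whose speed breakpoints all belong to $\mathcal{T}$, with associated degradation factors $\delta_{ij\ell}$ and $\Delta=\min_{(i,j)\in E,\ \ell=0,\dots,M}\delta_{ij\ell}$. If $\Delta=1$, then the arc ranking invariance property holds over $\mathcal{B}(\mathcal{T})$, i.e. $G$ is ranking invariant over $\mathcal{B}(\mathcal{T})$.
   Context: Graph and periods. $F$ (candidate facility locations) and $C$ (customers) are finite nonempty sets and $E=\{(i,j): i\in F, j\in C\}$. For each $(i,j)\in E$, $\tau_{ij}(t)$, $t\in[0,T]$, is the travel duration of the arc when leaving at time $t$; it is a nonnegative continuous piecewise linear function satisfying FIFO (leaving later implies arriving later). $\mathcal{T}=\{t_1,\dots,t_M\}$ with $t_0=0<t_1<\dots<t_M<t_{M+1}=T$; $\mathcal{I}_\ell=[t_\ell,t_{\ell+1}]$ for $\ell=0,\dots,M$, and $\mathcal{B}(\mathcal{T})=\{\mathcal{I}_0,\dots,\mathcal{I}_M\}$. For a time interval $\mathcal{I}$, $d_{ij}(\mathcal{I})=\max_{t\in\mathcal{I}}\tau_{ij}(t)$. Ranking invariance. Arc $(i,j)$ dominates arc $(r,s)$ over $\mathcal{B}(\mathcal{T})$ iff $d_{rs}(\mathcal{I}_\ell)\le d_{ij}(\mathcal{I}_\ell)$ for every $\ell=0,\dots,M$.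 $G$ is (arc) ranking invariant over $\mathcal{B}(\mathcal{T})$ if for any pair of arcs of $E$ the dominance rule holds, i.e. one of the two arcs dominates the other over $\mathcal{B}(\mathcal{T})$. IGP parameters. IGP parameters of $\tau_{ij}$ over $[0,T]$ are a constant $L_{ij}$ and a stepwise constant function $v_{ij}\ge 0$ such that $L_{ij}=\int_t^{t+\tau_{ij}(t)}v_{ij}(\mu)\,d\mu$ for all $t\in[0,T]$. All breakpoints of $v_{ij}$ belong to $\mathcal{T}$: $v_{ij}(t)=v_{ij\ell}$ for $t\in[t_\ell,t_{\ell+1})$, $\ell=0,\dots,M$ (so the last value $v_{ijM}$ persists after $T$). The speeds are factorized as $v_{ij\ell}=u_{ij}b_\ell\delta_{ij\ell}$ with $u_{ij}=\max_{\ell}v_{ij\ell}$, $b_\ell=\max_{(i,j)\in E}v_{ij\ell}/u_{ij}\in[0,1]$, $\delta_{ij\ell}=\frac{v_{ij\ell}/u_{ij}}{b_\ell}\in[0,1]$, where $u_{ij}>0$ and $b_\ell>0$ so that these quantities are defined. *)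

theory Defs
  imports "HOL-Analysis.Analysis"
begin

definition piecewise_linear_on :: "real \<Rightarrow> real \<Rightarrow> (real \<Rightarrow> real) \<Rightarrow> bool" where
  "piecewise_linear_on a b f \<longleftrightarrow>
     (\<exists>n (p :: nat \<Rightarrow> real). p 0 = a \<and> p n = b \<and>
        (\<forall>k<n. p k < p (Suc k) \<and>
           (\<exists>m c. \<forall>x\<in>{p k<..<p (Suc k)}. f x = m * x + c)))"

definition FIFO :: "real \<Rightarrow> (real \<Rightarrow> real) \<Rightarrow> bool" where
  "FIFO T \<tau> \<longleftrightarrow> mono_on {0..T} (\<lambda>s. s + \<tau> s)"

definition travel_time_function :: "real \<Rightarrow> (real \<Rightarrow> real) \<Rightarrow> bool" where
  "travel_time_function T \<tau> \<longleftrightarrow>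
     (\<forall>s\<in>{0..T}. 0 \<le> \<tau> s) \<and> continuous_on {0..T} \<tau> \<and>
     piecewise_linear_on 0 T \<tau> \<and> FIFO T \<tau>"

definition time_dependent_graph ::
    "'f set \<Rightarrow> 'c set \<Rightarrow> ('f \<times> 'c) set \<Rightarrow> real \<Rightarrow> ('f \<times> 'c \<Rightarrow> real \<Rightarrow> real) \<Rightarrow> bool" where
  "time_dependent_graph F C E T \<tau> \<longleftrightarrow>
     finite F \<and> F \<noteq> {} \<and> finite C \<and> C \<noteq> {} \<and> E = F \<times> C \<and>
     (\<forall>a\<in>E. travel_time_function T (\<tau> a))"

(* The time instants are t 1, ..., t M; the horizon endpoints are t 0 = 0 and t (M+1) = T. *)
definition time_instants :: "nat \<Rightarrow> (nat \<Rightarrow> real) \<Rightarrow> real \<Rightarrow> bool" where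
  "time_instants M t T \<longleftrightarrow> t 0 = 0 \<and> t (Suc M) = T \<and> (\<forall>l\<le>M. t l < t (Suc l))"

definition time_periods :: "nat \<Rightarrow> (nat \<Rightarrow> real) \<Rightarrow> real set set" where
  "time_periods M t = (\<lambda>l. {t l..t (Suc l)}) ` {0..M}"

definition max_duration :: "('a \<Rightarrow> real \<Rightarrow> real) \<Rightarrow> 'a \<Rightarrow> real set \<Rightarrow> real" where
  "max_duration \<tau> a I = (GREATEST y. y \<in> \<tau> a ` I)"

definition dominates :: "('a \<Rightarrow> real \<Rightarrow> real) \<Rightarrow> real set set \<Rightarrow> 'a \<Rightarrow> 'a \<Rightarrow> bool" where
  "dominates \<tau> \<B> a a' \<longleftrightarrow> (\<forall>I\<in>\<B>. max_duration \<tau> a' I \<le> max_duration \<tau> a I)"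

definition ranking_invariant :: "'a set \<Rightarrow> ('a \<Rightarrow> real \<Rightarrow> real) \<Rightarrow> real set set \<Rightarrow> bool" where
  "ranking_invariant E \<tau> \<B> \<longleftrightarrow>
     (\<forall>a\<in>E. \<forall>a'\<in>E. dominates \<tau> \<B> a a' \<or> dominates \<tau> \<B> a' a)"

(* Arrivals s + \<tau> s may exceed the horizon, so the last value is continued beyond it. *)
definition stepwise_constant :: "nat \<Rightarrow> (nat \<Rightarrow> real) \<Rightarrow> (nat \<Rightarrow> real) \<Rightarrow> (real \<Rightarrow> real) \<Rightarrow> bool" where
  "stepwise_constant M t w v \<longleftrightarrow>
     (\<forall>l\<le>M. \<forall>s\<in>{t l..<t (Suc l)}. v s = w l) \<and> (\<forall>s\<ge>t (Suc M). v s = w M)"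

(* L and v are IGP parameters of \<tau> over [0, T], where the breakpoints of v are among
   t 1, ..., t M and w l is the speed in period l. *)
definition igp_parameters ::
    "nat \<Rightarrow> (nat \<Rightarrow> real) \<Rightarrow> real \<Rightarrow> (real \<Rightarrow> real) \<Rightarrow> real \<Rightarrow> (real \<Rightarrow> real) \<Rightarrow> (nat \<Rightarrow> real) \<Rightarrow> bool" where
  "igp_parameters M t T \<tau> L v w \<longleftrightarrow>
     stepwise_constant M t w v \<and> (\<forall>\<mu>\<ge>0. 0 \<le> v \<mu>) \<and>
     (\<forall>s\<in>{0..T}. (v has_integral L) {s..s + \<tau> s})"

definition max_speed :: "nat \<Rightarrow> ('a \<Rightarrow> nat \<Rightarrow> real) \<Rightarrow> 'a \<Rightarrow> real" where
  "max_speed M w a = Max ((\<lambda>l. w a l) ` {0..M})"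

definition best_factor :: "'a set \<Rightarrow> nat \<Rightarrow> ('a \<Rightarrow> nat \<Rightarrow> real) \<Rightarrow> nat \<Rightarrow> real" where
  "best_factor E M w l = Max ((\<lambda>a. w a l / max_speed M w a) ` E)"

definition degradation :: "'a set \<Rightarrow> nat \<Rightarrow> ('a \<Rightarrow> nat \<Rightarrow> real) \<Rightarrow> 'a \<Rightarrow> nat \<Rightarrow> real" where
  "degradation E M w a l = (w a l / max_speed M w a) / best_factor E M w l"

definition min_degradation :: "'a set \<Rightarrow> nat \<Rightarrow> ('a \<Rightarrow> nat \<Rightarrow> real) \<Rightarrow> real" where
  "min_degradation E M w = Min ((\<lambda>(a, l). degradation E M w a l) ` (E \<times> {0..M}))"

end

theory Submission imports Defs begin

text \<open>
  Since all degradation factors are at most one, a minimum of one makes them all equal to one, so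
  every arc has speed \<open>u\<^sub>a b\<close> for a common positive profile \<open>b\<close>. The travel time
  from \<open>s\<close> is then the length of the interval starting at \<open>s\<close> over which \<open>b\<close>
  integrates to \<open>L\<^sub>a / u\<^sub>a\<close>. Hence the arc with the larger ratio \<open>L\<^sub>a / u\<^sub>a\<close> is the
  slower one at every departure time, and so over every period.
\<close>

text \<open>The index \<open>l\<close> is fixed before \<open>w\<close> and \<open>v\<close> are
  quantified, so one period serves all arcs at once; this is what later yields a common
  profile.\<close>

lemma stepwise_constant_value:
  assumes "t 0 \<le> x"
  obtains l where "l \<le> M" "\<And>w v. stepwise_constant M t w v \<Longrightarrow> v x = w l"
proof -
  \<comment> \<open>Induction over the first \<open>n\<close> periods; at \<open>n = Suc M\<close>
    the second alternative is the time from the horizon on, where the last value persists.\<close>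
  have "(\<exists>l<n. x \<in> {t l..<t (Suc l)}) \<or> t n \<le> x" for n
  proof (induction n)
    case (Suc n)
    then show ?case by (auto simp: less_Suc_eq)
  qed (use assms in simp)
  then consider l where "l \<le> M" "x \<in> {t l..<t (Suc l)}" | "t (Suc M) \<le> x"
    by (metis less_Suc_eq_le)
  then show thesis
  proof cases
    case 1
    then show ?thesis by (intro that[of l]) (auto simp: stepwise_constant_def)
  next
    case 2
    then show ?thesis by (intro that[of M]) (auto simp: stepwise_constant_def)
  qed
qed

lemma time_instants_mono:
  assumes "time_instants M t T" "k \<le> l" "l \<le> Suc M"
  shows "t k \<le> t l"
  using assms(2,3)
proof (induction l rule: dec_induct)
  case (step n)
  then have "t n < t (Suc n)"
    using assms(1) by (auto simp: time_instants_def)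
  then show ?case
    using step by simp
qed simp

lemma time_instants_period_subset:
  assumes "time_instants M t T" "l \<le> M"
  shows "t l < t (Suc l)" "{t l..t (Suc l)} \<subseteq> {0..T}"
  using assms time_instants_mono[OF assms(1), of 0 l] time_instants_mono[OF assms(1), of "Suc l" "Suc M"]
  by (auto simp: time_instants_def)

text \<open>The two integrals differ by the one over \<open>{p..q}\<close>, which the uniform bound
  \<open>c\<close> keeps at least \<open>c * (q - p) > 0\<close>.\<close>

lemma has_integral_less_of_pos:
  fixes f :: "real \<Rightarrow> real"
  assumes "(f has_integral I) {s..p}" "(f has_integral J) {s..q}"
    and "s \<le> p" "p < q" "c > 0" "\<And>x. x \<in> {p..q} \<Longrightarrow> c \<le> f x"
  shows "I < J"
proof -
  have "f integrable_on {p..q}"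
    using assms(2-4) integrable_subinterval_real[of f s q p q] by auto
  then obtain K where K: "(f has_integral K) {p..q}" by blast
  have "((\<lambda>x. c) has_integral c * (q - p)) {p..q}"
    using has_integral_const_real[of c p q] assms(4) by (simp add: mult.commute)
  then have "c * (q - p) \<le> K"
    using has_integral_le[OF _ K] assms(6) by blast
  moreover have "0 < c * (q - p)"
    using assms(4,5) by simp
  moreover have "J = I + K"
    using has_integral_unique[OF assms(2) has_integral_combine[OF _ _ assms(1) K]] assms(3,4) by simp
  ultimately show ?thesis by simp
qed

text \<open>Continuity on a compact interval makes each \<open>GREATEST\<close> an attained value,
  so it suffices to compare at a maximizer of \<open>\<tau> x\<close>.\<close>

lemma max_duration_mono:
  assumes "a \<le> b" "continuous_on {a..b} (\<tau> x)" "continuous_on {a..b} (\<tau> y)"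
    and "\<And>s. s \<in> {a..b} \<Longrightarrow> \<tau> x s \<le> \<tau> y s"
  shows "max_duration \<tau> x {a..b} \<le> max_duration \<tau> y {a..b}"
proof -
  have max: "\<exists>s\<in>{a..b}. max_duration \<tau> z {a..b} = \<tau> z s \<and> (\<forall>r\<in>{a..b}. \<tau> z r \<le> \<tau> z s)"
    if cont: "continuous_on {a..b} (\<tau> z)" for z
  proof -
    obtain s where s: "s \<in> {a..b}" "\<forall>r\<in>{a..b}. \<tau> z r \<le> \<tau> z s"
      using continuous_attains_sup[of "{a..b}" "\<tau> z"] cont assms(1) by auto
    then have "max_duration \<tau> z {a..b} = \<tau> z s"
      unfolding max_duration_def by (intro Greatest_equality) auto
    with s show ?thesis by blast
  qed
  show ?thesis
    using max[OF assms(2)] max[OF assms(3)] assms(4) by (metis order_trans)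
qed

text \<open>The minimum bounds the degradation below by one, while \<open>best_factor\<close>, a
  maximum over the arcs, bounds it above by one.\<close>

lemma speed_factorization:
  assumes "finite E" "a \<in> E" "l \<le> M"
    and "max_speed M w a > 0" "best_factor E M w l > 0" "min_degradation E M w = 1"
  shows "w a l = max_speed M w a * best_factor E M w l"
proof -
  have "1 \<le> degradation E M w a l"
    unfolding assms(6)[symmetric] min_degradation_def
    using assms(1-3) by (intro Min_le) force+
  moreover have "w a l / max_speed M w a \<le> best_factor E M w l"
    unfolding best_factor_def using assms(1,2) by (intro Max_ge) auto
  ultimately have "w a l / max_speed M w a = best_factor E M w l"
    using assms(5) by (simp add: degradation_def le_divide_eq_1 del: divide_divide_eq_left)
  then show ?thesis
    using assms(4) by (auto simp: field_simps)
qed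

theorem theorem1:
  fixes F :: "'f set" and C :: "'c set" and E :: "('f \<times> 'c) set"
    and T :: real and \<tau> :: "'f \<times> 'c \<Rightarrow> real \<Rightarrow> real"
    and M :: nat and t :: "nat \<Rightarrow> real"
    and L :: "'f \<times> 'c \<Rightarrow> real" and v :: "'f \<times> 'c \<Rightarrow> real \<Rightarrow> real"
    and w :: "'f \<times> 'c \<Rightarrow> nat \<Rightarrow> real"
  assumes "time_dependent_graph F C E T \<tau>"
    and "time_instants M t T"
    and "\<And>a. a \<in> E \<Longrightarrow> igp_parameters M t T (\<tau> a) (L a) (v a) (w a)"
    and "\<And>a. a \<in> E \<Longrightarrow> max_speed M w a > 0"
    and "\<And>l. l \<le> M \<Longrightarrow> best_factor E M w l > 0"
    and "min_degradation E M w = 1"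
  shows "ranking_invariant E \<tau> (time_periods M t)"
proof -
  define u where "u = max_speed M w"
  define b where "b = best_factor E M w"
  have graph: "finite E" "\<And>a. a \<in> E \<Longrightarrow> travel_time_function T (\<tau> a)"
    using assms(1) by (auto simp: time_dependent_graph_def)
  have u_pos: "u a > 0" if "a \<in> E" for a
    using assms(4) that by (simp add: u_def)
  have b_pos: "b l > 0" if "l \<le> M" for l
    using assms(5) that by (simp add: b_def)
  have w: "w a l = u a * b l" if "a \<in> E" "l \<le> M" for a l
    using speed_factorization[OF graph(1) that, of w] assms(4-6) that by (simp add: u_def b_def)
  \<comment> \<open>As there are finitely many periods, the smallest \<open>b l\<close> is a
    positive bound at all times, as the strict integral comparison requires.\<close>
  define c where "c = Min (b ` {0..M})"
  have c_pos: "c > 0"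
    unfolding c_def using b_pos by (subst Min_gr_iff) auto
  have c_le: "c \<le> b l" if "l \<le> M" for l
    unfolding c_def using that by (intro Min_le) auto
  \<comment> \<open>\<open>\<beta>\<close> depends on \<open>x\<close> but not on the arc. Times
    after \<open>T\<close> are included because arrivals may fall there.\<close>
  have profile: "\<exists>\<beta>\<ge>c. \<forall>a\<in>E. v a x = u a * \<beta>" if "0 \<le> x" for x
  proof -
    have "t 0 \<le> x"
      using assms(2) that by (simp add: time_instants_def)
    then obtain l where l: "l \<le> M" "\<And>w v. stepwise_constant M t w v \<Longrightarrow> v x = w l"
      using stepwise_constant_value by blast
    have "v a x = u a * b l" if "a \<in> E" for a
      using l(2)[of "w a" "v a"] assms(3)[OF that] w[OF that l(1)] by (simp add: igp_parameters_def)
    then show ?thesis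
      using c_le[OF l(1)] by blast
  qed
  have pointwise: "\<tau> a s \<le> \<tau> a' s"
    if a: "a \<in> E" and a': "a' \<in> E" and le: "L a / u a \<le> L a' / u a'" and s: "s \<in> {0..T}" for a a' s
  proof (rule ccontr)
    assume "\<not> \<tau> a s \<le> \<tau> a' s"
    then have less: "s + \<tau> a' s < s + \<tau> a s" by simp
    have nonneg: "0 \<le> \<tau> a' s"
      using graph(2)[OF a'] s by (auto simp: travel_time_function_def)
    have int: "((\<lambda>x. v z x / u z) has_integral L z / u z) {s..s + \<tau> z s}" if "z \<in> E" for z
      using assms(3)[OF that] s has_integral_divide unfolding igp_parameters_def by blast
    have same: "v a' x / u a' = v a x / u a" if "x \<in> {s..s + \<tau> a' s}" for x
      using profile[of x] that s a a' u_pos[OF a] u_pos[OF a'] by auto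
    \<comment> \<open>Over the trip of \<open>a'\<close> the normalized speeds of both arcs agree,
      so the two ratios become integrals of one function over nested intervals.\<close>
    have "((\<lambda>x. v a x / u a) has_integral L a' / u a') {s..s + \<tau> a' s}"
      using has_integral_eq[OF same int[OF a']] by simp
    moreover have "c \<le> v a x / u a" if "x \<in> {s + \<tau> a' s..s + \<tau> a s}" for x
      using profile[of x] that nonneg s a u_pos[OF a] by auto
    ultimately have "L a' / u a' < L a / u a"
      using has_integral_less_of_pos[OF _ int[OF a] _ less c_pos] nonneg by simp
    with le show False by simp
  qed
  have "dominates \<tau> (time_periods M t) a' a"
    if a: "a \<in> E" and a': "a' \<in> E" and le: "L a / u a \<le> L a' / u a'" for a a'
    unfolding dominates_def time_periods_def
  proof (clarsimp)
    fix l assume "l \<le> M"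
    note period = time_instants_period_subset[OF assms(2) this]
    have cont: "continuous_on {t l..t (Suc l)} (\<tau> z)" if "z \<in> E" for z
      using graph(2)[OF that] continuous_on_subset[OF _ period(2)]
      by (auto simp: travel_time_function_def)
    show "max_duration \<tau> a {t l..t (Suc l)} \<le> max_duration \<tau> a' {t l..t (Suc l)}"
      using period cont pointwise[OF a a' le] a a' by (intro max_duration_mono) auto
  qed
  \<comment> \<open>The ratios \<open>L a / u a\<close> are real numbers, so any two arcs are
    comparable.\<close>
  then show ?thesis
    unfolding ranking_invariant_def by (metis linear)
qed

end
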